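(* Let $N>2$ and let $K$ be an $N\times N$ random complex matrix such that $P[\|K\|<1]\ge 1-p_1(N)$ and $P[|K_{N,1}|<s]\le p_2(s;N)$ for all $s>0$. Then for any $0<\delta<\frac{1}{2N}$, any $\alpha\ge\delta$ and any $\sigma>0$, with probability at least $1-p_1(N)-p_2(5\alpha;N)$ we have both $$\mathrm{Spec}(J+\delta K)\subseteq D\bigl(0,(\delta N)^{1/N}\bigr)$$ and $$\#\Bigl(\mathrm{Spec}(J+\delta K)\cap D\bigl(0,(\delta N)^{1/N}e^{-\sigma}\bigr)\Bigr)\le\frac1\sigma(\ln N-\ln\alpha).$$
   Context: $J$ is the $N\times N$ Jordan matrix with $J_{r,s}=1$ if $s=r+1$ and $J_{r,s}=0$ otherwise ($r,s=1,\dots,N$). $\mathrm{Spec}$ denotes the spectrum (set of eigenvalues) of a matrix, $\|\cdot\|$ the operator norm induced by the Euclidean norm on $\mathbf{C}^N$, $D(w,r)=\{z\in\mathbf{C}:|z-w|\le r\}$, and $\#$ the number of elements. $p_1(N)$ and $p_2(s;N)$ are real numbers (for each $s>0$) for which the displayed hypotheses hold. *)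

theory Defs
  imports
    "HOL-Probability.Probability"
    "Jordan_Normal_Form.Spectral_Radius"
begin

text \<open>Euclidean norm on \<open>\<complex>\<^sup>n\<close> for vectors of type \<^typ>\<open>complex vec\<close>. The function
  \<^const>\<open>vec_index\<close> is written out because its infix form clashes with that of \<^const>\<open>vec_nth\<close>.\<close>

definition euclidean_vec_norm :: "complex vec \<Rightarrow> real" where
  "euclidean_vec_norm v = L2_set (\<lambda>i. cmod (vec_index v i)) {..<dim_vec v}"

definition mat_op_norm :: "complex mat \<Rightarrow> real" where
  "mat_op_norm A =
     (SUP v\<in>{v \<in> carrier_vec (dim_col A). euclidean_vec_norm v \<le> 1}. euclidean_vec_norm (A *\<^sub>v v))"

text \<open>The matrix \<open>J\<close> with ones on the superdiagonal is the library's \<^const>\<open>jordan_block\<close> of size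
  \<open>N\<close> with eigenvalue \<open>0\<close>. Matrix indices of \<^typ>\<open>complex mat\<close> start at \<open>0\<close>, so the entry
  \<open>K\<^sub>N\<^sub>,\<^sub>1\<close> (bottom-left corner) is at position \<open>(N - 1, 0)\<close>.\<close>

end

theory Submission
  imports Defs "HOL-Complex_Analysis.Conformal_Mappings"
begin

text \<open>
  The probability only enters through a union bound: outside an event of probability at most
  \<open>p1 N + p2 (5 * \<alpha>) N\<close> the matrix \<open>K\<close> is a contraction whose bottom-left entry has modulus at
  least \<open>5\<alpha>\<close>, and for such a \<open>K\<close> both conclusions hold deterministically. Write
  \<open>A = J + \<delta>K\<close> and \<open>R = (\<delta>N)\<^bsup>1/N\<^esup>\<close>; coordinates are numbered from \<open>0\<close> to \<open>N - 1\<close>.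

  Every eigenvalue lies in the disc of radius \<open>R\<close> because \<open>\<parallel>(z - J)\<^sup>-\<^sup>1\<parallel> \<le> N / |z|\<^bsup>N\<^esup>\<close> for
  \<open>0 < |z| \<le> 1\<close>, so that an eigenvector for \<open>z\<close> forces \<open>|z|\<^bsup>N\<^esup> \<le> \<delta>N\<close> (\<open>eigenvalue_bound\<close>). For
  \<open>|z| > 1\<close> that norm is at most \<open>N\<close>, and \<open>\<delta>N < 1/2\<close> excludes an eigenvector.

  For the number of small eigenvalues, consider the last column \<open>w(z)\<close> of the adjugate of
  \<open>z - A\<close>. It satisfies \<open>(z - A) w = \<chi>(z) e\<^sub>N\<^sub>-\<^sub>1\<close>, where \<open>\<chi>\<close> is the characteristic
  polynomial. All rows but the last determine \<open>w\<close> from its first entry \<open>w\<^sub>0\<close>, as a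
  perturbation of \<open>w\<^sub>i = z\<^bsup>i\<^esup> w\<^sub>0\<close>, and the last row then compares \<open>\<chi>\<close> with \<open>w\<^sub>0\<close>: for
  \<open>|z| \<le> 1\<close> one gets \<open>|\<chi>(z)| \<le> (|z|\<^bsup>N\<^esup> + 2\<delta>N) |w\<^sub>0(z)|\<close>, while at \<open>z = 0\<close> the bottom-left
  entry dominates and \<open>|\<chi>(0)| \<ge> \<delta> (5\<alpha> - 2\<delta>) |w\<^sub>0(0)|\<close>. As \<open>w\<^sub>0\<close> is a minor of \<open>z - A\<close>, it is a
  polynomial in \<open>z\<close>, and it has no zero in the unit disc (\<open>corner_minor_nonzero\<close>). So
  \<open>g = \<chi> / w\<^sub>0\<close> is holomorphic there, its zeros are the eigenvalues, \<open>|g| \<le> 3\<delta>N\<close> on the circle of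
  radius \<open>R\<close> and \<open>|g(0)| \<ge> 3\<alpha>\<delta>\<close>. This \<open>g\<close> plays the part of the effective Hamiltonian of a
  Grushin problem. Jensen's inequality (\<open>jensen_bound\<close>) bounds the number \<open>n\<close> of zeros in the
  disc of radius \<open>R e\<^bsup>-\<sigma>\<^esup>\<close> by \<open>3\<alpha>\<delta> e\<^bsup>\<sigma>n\<^esup> \<le> 3\<delta>N\<close>, which is the claim.

  The probability of a set outside the \<open>\<sigma>\<close>-algebra is zero by convention, so the event in the
  conclusion has to be shown measurable. This rests on the measurability of the event that the
  spectrum meets a given compact set (\<open>measurable_spectrum_hit\<close>), from which inclusion of the
  spectrum in a disc and the number of its points in a closed set are recovered.
\<close>

unbundle no vec_syntax

section \<open>Euclidean norm and contractive matrices\<close>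

text \<open>Vectors are represented by functions on all natural numbers, of which only the first
  \<open>n\<close> values count. Index shifts then need no change of dimension.\<close>

definition fun_norm :: "nat \<Rightarrow> (nat \<Rightarrow> complex) \<Rightarrow> real" where
  "fun_norm n u = L2_set (\<lambda>i. cmod (u i)) {..<n}"

definition mat_act :: "complex mat \<Rightarrow> (nat \<Rightarrow> complex) \<Rightarrow> nat \<Rightarrow> complex" where
  "mat_act A u i = (\<Sum>j<dim_col A. A $$ (i, j) * u j)"

lemma fun_norm_nonneg [simp]: "0 \<le> fun_norm n u"
  by (simp add: fun_norm_def)

lemma fun_norm_triangle: "fun_norm n (\<lambda>i. u i + v i) \<le> fun_norm n u + fun_norm n v"
proof -
  have "fun_norm n (\<lambda>i. u i + v i) \<le> L2_set (\<lambda>i. cmod (u i) + cmod (v i)) {..<n}"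
    unfolding fun_norm_def by (intro L2_set_mono norm_triangle_ineq) auto
  also have "\<dots> \<le> fun_norm n u + fun_norm n v"
    unfolding fun_norm_def by (rule L2_set_triangle_ineq)
  finally show ?thesis .
qed

lemma fun_norm_mult: "fun_norm n (\<lambda>i. c * u i) = cmod c * fun_norm n u"
  by (simp add: fun_norm_def norm_mult L2_set_right_distrib)

lemma norm_le_fun_norm: "i < n \<Longrightarrow> cmod (u i) \<le> fun_norm n u"
  unfolding fun_norm_def by (rule member_le_L2_set) auto

lemma sum_norm_le_fun_norm: "(\<Sum>i<n. cmod (u i)) \<le> sqrt (real n) * fun_norm n u"
  using L2_set_mult_ineq[of "\<lambda>_. 1" "\<lambda>i. cmod (u i)" "{..<n}"]
  by (simp add: fun_norm_def L2_set_constant)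

lemma fun_norm_le_sqrt_mult:
  assumes "\<And>i. i < n \<Longrightarrow> cmod (u i) \<le> c"
  shows "fun_norm n u \<le> sqrt (real n) * c"
proof (cases "n = 0")
  case False
  then have "0 \<le> c" using assms[of 0] norm_ge_zero[of "u 0"] by linarith
  have "fun_norm n u \<le> L2_set (\<lambda>_. c) {..<n}"
    unfolding fun_norm_def by (intro L2_set_mono) (use assms in auto)
  then show ?thesis using \<open>0 \<le> c\<close> by (simp add: L2_set_constant)
qed (simp add: fun_norm_def)

lemma fun_norm_eq_0: "fun_norm n u = 0 \<Longrightarrow> i < n \<Longrightarrow> u i = 0"
  using norm_le_fun_norm[of i n u] by simp

lemma mat_act_vec:
  assumes "A \<in> carrier_mat n m" "i < n"
  shows "mat_act A u i = (A *\<^sub>v Matrix.vec m u) $ i"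
  using assms by (auto simp: mat_act_def scalar_prod_def lessThan_atLeast0 intro!: sum.cong)

text \<open>A supremum over an unbounded set would carry no information, so the images of the unit ball
  are first bounded by the sum of the moduli of the entries. The rest is homogeneity.\<close>
lemma mat_act_le_of_op_norm:
  assumes A: "A \<in> carrier_mat n n" and op: "mat_op_norm A < 1"
  shows "fun_norm n (mat_act A u) \<le> fun_norm n u"
proof -
  have conv: "euclidean_vec_norm (A *\<^sub>v Matrix.vec n u) = fun_norm n (mat_act A u)" for u
    using A by (auto simp: euclidean_vec_norm_def fun_norm_def mat_act_vec[OF A] intro!: L2_set_cong)
  have conv': "euclidean_vec_norm v = fun_norm n (vec_index v)" if "v \<in> carrier_vec n" for v
    using that by (simp add: euclidean_vec_norm_def fun_norm_def)
  define S where "S = (\<Sum>i<n. \<Sum>j<n. cmod (A $$ (i,j)))"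
  have S: "fun_norm n (mat_act A u) \<le> S" if "fun_norm n u \<le> 1" for u
  proof -
    have "fun_norm n (mat_act A u) \<le> (\<Sum>i<n. cmod (mat_act A u i))"
      unfolding fun_norm_def by (rule L2_set_le_sum) auto
    also have "\<dots> \<le> S"
      unfolding S_def
    proof (intro sum_mono)
      fix i assume "i \<in> {..<n}"
      have "cmod (mat_act A u i) \<le> (\<Sum>j<n. cmod (A $$ (i,j) * u j))"
        using A unfolding mat_act_def by (auto intro: norm_sum)
      also have "\<dots> \<le> (\<Sum>j<n. cmod (A $$ (i,j)))"
      proof (rule sum_mono)
        fix j assume "j \<in> {..<n}"
        then have "cmod (u j) \<le> 1" using norm_le_fun_norm[of j n u] that by simp
        then show "cmod (A $$ (i,j) * u j) \<le> cmod (A $$ (i,j))"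
          by (simp add: norm_mult mult_left_le)
      qed
      finally show "cmod (mat_act A u i) \<le> (\<Sum>j<n. cmod (A $$ (i,j)))" .
    qed
    finally show ?thesis .
  qed
  have vec_id: "Matrix.vec n (vec_index v) = v" if "v \<in> carrier_vec n" for v :: "complex vec"
    using that by auto
  have unit: "fun_norm n (mat_act A u) < 1" if u: "fun_norm n u \<le> 1" for u
  proof -
    let ?V = "{v \<in> carrier_vec (dim_col A). euclidean_vec_norm v \<le> 1}"
    have "bdd_above ((\<lambda>v. euclidean_vec_norm (A *\<^sub>v v)) ` ?V)"
    proof (rule bdd_aboveI2)
      fix v assume "v \<in> ?V"
      then have v: "v \<in> carrier_vec n" "fun_norm n (vec_index v) \<le> 1" using A conv' by auto
      show "euclidean_vec_norm (A *\<^sub>v v) \<le> S"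
        using S[OF v(2)] conv[of "vec_index v"] vec_id[OF v(1)] by simp
    qed
    moreover have "fun_norm n (vec_index (Matrix.vec n u)) = fun_norm n u"
      unfolding fun_norm_def by (rule L2_set_cong) auto
    then have "Matrix.vec n u \<in> ?V" using A u conv'[of "Matrix.vec n u"] by auto
    ultimately have "euclidean_vec_norm (A *\<^sub>v Matrix.vec n u) \<le> mat_op_norm A"
      unfolding mat_op_norm_def by (rule cSUP_upper2) auto
    then show ?thesis using op conv by simp
  qed
  show ?thesis
  proof (cases "fun_norm n u = 0")
    case True
    have "mat_act A u i = 0" for i
      using A fun_norm_eq_0[OF True] by (auto simp: mat_act_def intro!: sum.neutral)
    then have "fun_norm n (mat_act A u) = 0"
      unfolding fun_norm_def by (intro L2_set_0') auto
    then show ?thesis by simp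
  next
    case False
    define c where "c = complex_of_real (1 / fun_norm n u)"
    have c: "cmod c = 1 / fun_norm n u" by (simp add: c_def norm_divide)
    have "fun_norm n (\<lambda>i. c * u i) \<le> 1" using False by (simp add: fun_norm_mult c)
    from unit[OF this] have "fun_norm n (mat_act A (\<lambda>i. c * u i)) < 1" .
    moreover have "mat_act A (\<lambda>i. c * u i) = (\<lambda>i. c * mat_act A u i)"
      by (auto simp: mat_act_def sum_distrib_left algebra_simps)
    moreover have "0 < fun_norm n u" using False fun_norm_nonneg[of n u] by linarith
    ultimately show ?thesis by (simp add: fun_norm_mult c field_simps)
  qed
qed

text \<open>Unrolled, the recursion says that \<open>u i - z\<^bsup>i\<^esup> u 0\<close> is a combination of the \<open>f k\<close> whose
  coefficients are powers of \<open>z\<close> up to sign.\<close>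
lemma recursion_deviation:
  fixes u f :: "nat \<Rightarrow> complex"
  assumes z: "cmod z \<le> 1" and rec: "\<And>i. i < m \<Longrightarrow> u (Suc i) = z * u i - f i" and "i \<le> m"
  shows "cmod (u i - z ^ i * u 0) \<le> (\<Sum>k<i. cmod (f k))"
  using \<open>i \<le> m\<close>
proof (induction i)
  case (Suc i)
  have "u (Suc i) - z ^ Suc i * u 0 = z * (u i - z ^ i * u 0) - f i"
    using rec[of i] Suc.prems by (simp add: algebra_simps)
  then have "cmod (u (Suc i) - z ^ Suc i * u 0) \<le> cmod z * cmod (u i - z ^ i * u 0) + cmod (f i)"
    by (metis norm_triangle_ineq4 norm_mult)
  also have "\<dots> \<le> cmod (u i - z ^ i * u 0) + cmod (f i)"
    using z by (simp add: mult_left_le_one_le)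
  finally show ?case using Suc by simp
qed simp


section \<open>Counting zeros by Jensen's inequality\<close>
lemma prod_linear_dvd_of_roots:
  fixes p :: "'a::field poly"
  assumes "finite S" "\<And>x. x \<in> S \<Longrightarrow> poly p x = 0"
  shows "(\<Prod>x\<in>S. [:- x, 1:]) dvd p"
  using assms
proof (induction S)
  case (insert a S)
  then obtain q where q: "p = (\<Prod>x\<in>S. [:- x, 1:]) * q" by (auto simp: dvd_def)
  have "poly (\<Prod>x\<in>S. [:- x, 1:]) a \<noteq> 0" using insert by (auto simp: poly_prod)
  then have "poly q a = 0" using insert.prems[of a] q by simp
  then have "[:- a, 1:] dvd q" by (simp add: poly_eq_0_iff_dvd)
  then have "(\<Prod>x\<in>S. [:- x, 1:]) * [:- a, 1:] dvd p" unfolding q by (rule mult_dvd_mono[OF dvd_refl])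
  then show ?case using insert by (simp add: mult.commute)
qed simp

text \<open>Jensen's inequality for \<open>p / d\<close>. Multiplying \<open>p / d\<close> by the inverse Blaschke factors
  \<open>(R\<^sup>2 - \<lambda>\<^sup>* z) / (R (z - \<lambda>))\<close>, for \<open>\<lambda>\<close> in \<open>S\<close>, keeps it holomorphic, does not change its modulus on the
  circle of radius \<open>R\<close>, and increases its modulus at \<open>0\<close> by at least \<open>e\<^bsup>\<sigma>\<^esup>\<close> per factor. The
  maximum modulus principle does the rest. The linear factors of \<open>S\<close> are cancelled against
  \<open>p\<close> beforehand, so that \<open>0\<close> itself may belong to \<open>S\<close>.\<close>
lemma jensen_bound:
  fixes p d :: "complex poly" and R b B \<sigma> :: real and S :: "complex set"
  assumes R: "0 < R" and "finite S"
    and roots: "\<And>z. z \<in> S \<Longrightarrow> poly p z = 0" and small: "S \<subseteq> cball 0 (R * exp (- \<sigma>))"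
    and d: "\<And>z. cmod z \<le> R \<Longrightarrow> poly d z \<noteq> 0"
    and upper: "\<And>z. cmod z = R \<Longrightarrow> cmod (poly p z) \<le> B * cmod (poly d z)"
    and lower: "b * cmod (poly d 0) \<le> cmod (poly p 0)"
  shows "b * exp (\<sigma> * real (card S)) \<le> B"
proof -
  obtain q where q: "p = (\<Prod>x\<in>S. [:- x, 1:]) * q"
    using prod_linear_dvd_of_roots[OF \<open>finite S\<close> roots] by (auto simp: dvd_def)
  have p: "poly p z = (\<Prod>x\<in>S. z - x) * poly q z" for z by (simp add: q poly_prod)
  define h where "h z = poly q z * (\<Prod>x\<in>S. (complex_of_real (R ^ 2) - cnj x * z) / complex_of_real R) / poly d z" for z
  have h0: "cmod (h 0) \<le> B"
  proof (rule maximum_modulus_frontier[of h "cball 0 R"])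
    show "h holomorphic_on interior (cball 0 R)"
      unfolding h_def using d R by (intro holomorphic_intros) auto
    show "continuous_on (closure (cball 0 R)) h"
      unfolding h_def using d R by (intro continuous_intros) auto
    fix z :: complex assume "z \<in> frontier (cball 0 R)"
    then have z: "cmod z = R" using R by simp
    have *: "cmod ((complex_of_real (R ^ 2) - cnj x * z) / complex_of_real R) = cmod (z - x)" for x
    proof -
      have "complex_of_real (R ^ 2) - cnj x * z = z * cnj (z - x)"
        using complex_norm_square[of z] z by (simp add: algebra_simps)
      then show ?thesis using z R by (simp add: norm_divide norm_mult del: complex_cnj_diff)
    qed
    have "cmod (\<Prod>x\<in>S. (complex_of_real (R ^ 2) - cnj x * z) / complex_of_real R) = cmod (\<Prod>x\<in>S. z - x)"
      unfolding prod_norm[symmetric] * ..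
    then have "cmod (h z) = cmod (poly p z) / cmod (poly d z)"
      by (simp only: h_def p norm_mult norm_divide mult.commute)
    then show "cmod (h z) \<le> B" using upper[OF z] d[of z] z by (simp add: divide_le_eq)
  qed (use R in auto)
  have d0: "cmod (poly d 0) > 0" using d[of 0] R by simp
  have "cmod (\<Prod>x\<in>S. 0 - x) \<le> (\<Prod>x\<in>S. R * exp (- \<sigma>))"
    unfolding prod_norm[symmetric] using small by (intro prod_mono) auto
  also have "\<dots> = R ^ card S * exp (- (\<sigma> * real (card S)))"
    by (simp add: power_mult_distrib exp_of_nat_mult[symmetric] mult.commute)
  finally have "cmod (poly p 0) \<le> R ^ card S * exp (- (\<sigma> * real (card S))) * cmod (poly q 0)"
    unfolding p norm_mult by (rule mult_right_mono) simp
  then have "exp (\<sigma> * real (card S)) * cmod (poly p 0) \<le> R ^ card S * cmod (poly q 0)"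
    by (simp add: exp_minus field_simps)
  moreover have "cmod (h 0) = R ^ card S * cmod (poly q 0) / cmod (poly d 0)"
    using R by (simp add: h_def norm_mult norm_divide prod_constant norm_power power2_eq_square mult.commute)
  then have "R ^ card S * cmod (poly q 0) \<le> B * cmod (poly d 0)"
    using h0 d0 by (simp add: divide_le_eq)
  moreover have "exp (\<sigma> * real (card S)) * (b * cmod (poly d 0)) \<le> exp (\<sigma> * real (card S)) * cmod (poly p 0)"
    using lower by (intro mult_left_mono) auto
  ultimately have "exp (\<sigma> * real (card S)) * (b * cmod (poly d 0)) \<le> B * cmod (poly d 0)"
    by linarith
  then have "(b * exp (\<sigma> * real (card S))) * cmod (poly d 0) \<le> B * cmod (poly d 0)"
    by (simp only: ac_simps)
  then show ?thesis using d0 by simp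
qed

section \<open>Measurability of spectral events\<close>

text \<open>By compactness, a continuous function has a zero in \<open>C\<close> iff it takes arbitrarily small
  values there, and these can be sought in a countable dense subset.\<close>
lemma measurable_ex_zero:
  fixes f :: "'w \<Rightarrow> 'a::euclidean_space \<Rightarrow> complex"
  assumes C: "compact C" and meas: "\<And>z. z \<in> C \<Longrightarrow> (\<lambda>\<omega>. f \<omega> z) \<in> borel_measurable M"
    and cont: "\<And>\<omega>. \<omega> \<in> space M \<Longrightarrow> continuous_on C (f \<omega>)"
  shows "{\<omega> \<in> space M. \<exists>z\<in>C. f \<omega> z = 0} \<in> sets M"
proof -
  obtain D where D: "countable D" "D \<subseteq> C" "C \<subseteq> closure D" using separable by blast
  have "(\<exists>z\<in>C. f \<omega> z = 0) \<longleftrightarrow> (\<forall>n. \<exists>z\<in>D. cmod (f \<omega> z) < 1 / Suc n)" if \<omega>: "\<omega> \<in> space M" for \<omega>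
  proof
    assume "\<exists>z\<in>C. f \<omega> z = 0"
    then obtain z where z: "z \<in> C" "f \<omega> z = 0" by blast
    show "\<forall>n. \<exists>z\<in>D. cmod (f \<omega> z) < 1 / Suc n"
    proof
      fix n
      obtain e where e: "e > 0" "\<And>x. x \<in> C \<Longrightarrow> dist x z < e \<Longrightarrow> dist (f \<omega> x) (f \<omega> z) < 1 / Suc n"
        using cont[OF \<omega>] z(1) unfolding continuous_on_iff by (metis of_nat_0_less_iff zero_less_Suc zero_less_divide_1_iff)
      obtain x where "x \<in> D" "dist x z < e"
        using D(3) z(1) e(1) by (metis closure_approachable subsetD)
      then show "\<exists>z\<in>D. cmod (f \<omega> z) < 1 / Suc n" using e(2)[of x] D(2) z(2) by auto
    qed
  next
    assume small: "\<forall>n. \<exists>z\<in>D. cmod (f \<omega> z) < 1 / Suc n"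
    then have "C \<noteq> {}" using D(2) by blast
    then obtain x where x: "x \<in> C" "\<And>y. y \<in> C \<Longrightarrow> cmod (f \<omega> x) \<le> cmod (f \<omega> y)"
      using continuous_attains_inf[OF C, of "\<lambda>z. cmod (f \<omega> z)"] cont[OF \<omega>] continuous_on_norm by blast
    have "f \<omega> x = 0"
    proof (rule ccontr)
      assume "f \<omega> x \<noteq> 0"
      then obtain n where "1 / Suc n < cmod (f \<omega> x)"
        using reals_Archimedean[of "cmod (f \<omega> x)"] by (auto simp: inverse_eq_divide)
      moreover obtain z where "z \<in> D" "cmod (f \<omega> z) < 1 / Suc n" using small by blast
      ultimately show False using x(2)[of z] D(2) by force
    qed
    then show "\<exists>z\<in>C. f \<omega> z = 0" using x(1) by blast
  qed
  then have "{\<omega> \<in> space M. \<exists>z\<in>C. f \<omega> z = 0}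
      = {\<omega> \<in> space M. \<forall>n. \<exists>z\<in>D. cmod (f \<omega> z) < 1 / Suc n}" by blast
  also have "\<dots> \<in> sets M"
  proof -
    have less_sets: "{\<omega> \<in> space M. cmod (f \<omega> z) < 1 / Suc n} \<in> sets M" if "z \<in> D" for z n
    proof -
      have [measurable]: "(\<lambda>\<omega>. f \<omega> z) \<in> borel_measurable M" using meas that D(2) by blast
      show ?thesis by measurable
    qed
    show ?thesis
      by (intro sets.sets_Collect_countable_All sets.sets_Collect_countable_Ex' less_sets D(1))
  qed
  finally show ?thesis .
qed

text \<open>Distinct points can be separated by balls from a countable family, which turns the statement
  that \<open>S\<close> has at least \<open>k\<close> points into a countable combination of statements that \<open>S\<close> meets
  a given ball.\<close>
lemma card_ge_iff_disjoint_balls: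
  fixes S D :: "'a::metric_space set"
  assumes "finite S" and dense: "\<And>x e. 0 < e \<Longrightarrow> \<exists>q\<in>D. dist q x < e"
  defines "Q \<equiv> (\<lambda>(q, n). cball q (1 / Suc n)) ` (D \<times> UNIV)"
  shows "k \<le> card S \<longleftrightarrow> (\<exists>F. F \<subseteq> Q \<and> finite F \<and> card F = k \<and> disjoint F \<and> (\<forall>b\<in>F. b \<inter> S \<noteq> {}))"
proof
  assume "k \<le> card S"
  then obtain T where T: "T \<subseteq> S" "card T = k" "finite T"
    using obtain_subset_with_card_n by metis
  obtain e where e: "e > 0" "\<And>x y. x \<in> T \<Longrightarrow> y \<in> T \<Longrightarrow> x \<noteq> y \<Longrightarrow> e \<le> dist x y"
  proof -
    let ?E = "insert 1 ((\<lambda>(x, y). dist x y) ` {(x, y) \<in> T \<times> T. x \<noteq> y})"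
    have fin: "finite ?E" using T(3) by (auto intro: finite_subset[of _ "T \<times> T"])
    show ?thesis
    proof (rule that[of "Min ?E"])
      show "0 < Min ?E" using fin by (subst Min_gr_iff) auto
      show "Min ?E \<le> dist x y" if "x \<in> T" "y \<in> T" "x \<noteq> y" for x y
        using fin that by (intro Min_le) auto
    qed
  qed
  \<comment> \<open>Distances up to \<open>e / 4\<close> from point to centre and from centre to rim keep the balls disjoint.\<close>
  obtain n where n: "1 / Suc n < e / 4"
    using reals_Archimedean[of "e / 4"] e(1) by (auto simp: inverse_eq_divide)
  have "\<forall>x. \<exists>q\<in>D. dist q x < 1 / Suc n" using dense by simp
  then obtain c where c: "\<And>x. c x \<in> D" "\<And>x. dist (c x) x < 1 / Suc n" by metis
  let ?b = "\<lambda>x. cball (c x) (1 / Suc n)"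
  have disj: "?b x \<inter> ?b y = {}" if "x \<in> T" "y \<in> T" "x \<noteq> y" for x y
  proof (rule ccontr)
    assume "?b x \<inter> ?b y \<noteq> {}"
    then obtain w where "dist (c x) w \<le> 1 / Suc n" "dist (c y) w \<le> 1 / Suc n" by auto
    then have "dist x y < e"
      using c(2)[of x] c(2)[of y] n dist_triangle[of x y w] dist_triangle[of x w "c x"] dist_triangle[of w y "c y"]
      by (simp add: dist_commute)
    then show False using e(2)[OF that] by simp
  qed
  have mem: "x \<in> ?b x" for x using c(2)[of x] by simp
  have "inj_on ?b T"
  proof (rule inj_onI, rule ccontr)
    fix x y assume xy: "x \<in> T" "y \<in> T" "?b x = ?b y" "x \<noteq> y"
    show False using disj[OF xy(1,2,4)] mem[of x] xy(3) by blast
  qed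
  then have "card (?b ` T) = k" using T(2) by (simp add: card_image)
  moreover have "?b ` T \<subseteq> Q" using c(1) by (auto simp: Q_def)
  moreover have "disjoint (?b ` T)"
  proof (rule disjointI)
    fix a b assume "a \<in> ?b ` T" "b \<in> ?b ` T" "a \<noteq> b"
    then obtain x y where xy: "x \<in> T" "y \<in> T" "a = ?b x" "b = ?b y" by blast
    then have "x \<noteq> y" using \<open>a \<noteq> b\<close> by blast
    then show "a \<inter> b = {}" using disj xy by simp
  qed
  moreover have "\<forall>b\<in>?b ` T. b \<inter> S \<noteq> {}" using mem T(1) by blast
  ultimately show "\<exists>F. F \<subseteq> Q \<and> finite F \<and> card F = k \<and> disjoint F \<and> (\<forall>b\<in>F. b \<inter> S \<noteq> {})"
    using T(3) by blast
next
  assume "\<exists>F. F \<subseteq> Q \<and> finite F \<and> card F = k \<and> disjoint F \<and> (\<forall>b\<in>F. b \<inter> S \<noteq> {})"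
  then obtain F where F: "card F = k" "disjoint F" "\<forall>b\<in>F. b \<inter> S \<noteq> {}" by blast
  have "\<forall>b\<in>F. \<exists>x. x \<in> b \<inter> S" using F(3) by blast
  then obtain s where s: "\<And>b. b \<in> F \<Longrightarrow> s b \<in> b \<inter> S" by metis
  have "inj_on s F"
  proof (rule inj_onI, rule ccontr)
    fix a b assume ab: "a \<in> F" "b \<in> F" "s a = s b" "a \<noteq> b"
    then have "a \<inter> b = {}" using F(2) by (auto simp: disjoint_def)
    then show False using s[OF ab(1)] s[OF ab(2)] ab(3) by auto
  qed
  then have "card F \<le> card S" using s \<open>finite S\<close> by (intro card_inj_on_le[of s]) auto
  then show "k \<le> card S" using F(1) by simp
qed

lemma measurable_card_of_hits:
  fixes Z :: "'w \<Rightarrow> 'a::euclidean_space set"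
  assumes fin: "\<And>\<omega>. \<omega> \<in> space M \<Longrightarrow> finite (Z \<omega>)"
    and hit: "\<And>C. compact C \<Longrightarrow> {\<omega> \<in> space M. C \<inter> Z \<omega> \<noteq> {}} \<in> sets M"
    and B: "closed B"
  shows "(\<lambda>\<omega>. real (card (Z \<omega> \<inter> B))) \<in> borel_measurable M"
proof -
  obtain D :: "'a set" where D: "countable D" "\<And>X. open X \<Longrightarrow> X \<noteq> {} \<Longrightarrow> \<exists>d\<in>D. d \<in> X"
    using countable_dense_setE by blast
  have dense: "\<exists>q\<in>D. dist q x < e" if "0 < e" for x e
    using D(2)[of "ball x e"] that by (auto simp: dist_commute)
  define Q where "Q = (\<lambda>(q, n). cball q (1 / Suc n)) ` (D \<times> (UNIV :: nat set))"
  have "countable Q" unfolding Q_def using D(1) by simp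
  define FF where "FF k = {F. F \<subseteq> Q \<and> finite F \<and> card F = k \<and> disjoint F}" for k
  have FF: "countable (FF k)" for k
    by (rule countable_subset[OF _ countable_Collect_finite_subset[OF \<open>countable Q\<close>]]) (auto simp: FF_def)
  have card_ge: "{\<omega> \<in> space M. k \<le> card (Z \<omega> \<inter> B)} \<in> sets M" for k
  proof -
    have "{\<omega> \<in> space M. k \<le> card (Z \<omega> \<inter> B)}
        = {\<omega> \<in> space M. \<exists>F\<in>FF k. \<forall>b\<in>F. (b \<inter> B) \<inter> Z \<omega> \<noteq> {}}"
    proof (intro Collect_cong conj_cong refl)
      fix \<omega> assume "\<omega> \<in> space M"
      then have "finite (Z \<omega> \<inter> B)" using fin by simp
      from card_ge_iff_disjoint_balls[OF this dense, of k]
      show "k \<le> card (Z \<omega> \<inter> B) \<longleftrightarrow> (\<exists>F\<in>FF k. \<forall>b\<in>F. (b \<inter> B) \<inter> Z \<omega> \<noteq> {})"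
        unfolding Q_def[symmetric] FF_def by (simp add: Int_ac conj_ac Bex_def)
    qed
    also have "\<dots> \<in> sets M"
    proof (intro sets.sets_Collect_countable_Ex'[OF _ FF] sets.sets_Collect_finite_All hit)
      fix F b assume "F \<in> FF k" "b \<in> F"
      then show "compact (b \<inter> B)" using B by (auto simp: FF_def Q_def intro!: compact_Int_closed)
    qed (simp add: FF_def)
    finally show ?thesis .
  qed
  have "a \<le> real n \<longleftrightarrow> nat \<lceil>a\<rceil> \<le> n" for a n by linarith
  then show ?thesis using card_ge unfolding borel_measurable_iff_ge by presburger
qed

text \<open>The complement of a closed ball is a countable union of compact annuli \<open>C n\<close>.\<close>
lemma measurable_subset_cball_of_hits:
  fixes Z :: "'w \<Rightarrow> 'a::euclidean_space set"
  assumes hit: "\<And>C. compact C \<Longrightarrow> {\<omega> \<in> space M. C \<inter> Z \<omega> \<noteq> {}} \<in> sets M"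
  shows "{\<omega> \<in> space M. Z \<omega> \<subseteq> cball 0 r} \<in> sets M"
proof -
  define C :: "nat \<Rightarrow> 'a set" where "C n = cball 0 (real n) - ball 0 (r + 1 / Suc n)" for n
  have C: "r < norm x \<longleftrightarrow> (\<exists>n. x \<in> C n)" for x
  proof
    assume "r < norm x"
    then have "0 < norm x - r" by simp
    from reals_Archimedean[OF this] obtain n2 where n2: "1 / Suc n2 < norm x - r"
      unfolding inverse_eq_divide by blast
    obtain n1 where n1: "norm x \<le> real n1" using real_arch_simple by blast
    have "1 / Suc (max n1 n2) \<le> 1 / Suc n2" by (simp add: frac_le)
    then have "x \<in> C (max n1 n2)" using n1 n2 by (simp add: C_def)
    then show "\<exists>n. x \<in> C n" by blast
  next
    assume "\<exists>n. x \<in> C n"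
    then obtain n where n: "r + 1 / Suc n \<le> norm x" by (auto simp: C_def not_less simp del: of_nat_Suc)
    have "0 < 1 / real (Suc n)" by simp
    then show "r < norm x" using n by linarith
  qed
  have "Z \<omega> \<subseteq> cball 0 r \<longleftrightarrow> (\<forall>x\<in>Z \<omega>. \<not> r < norm x)" for \<omega>
    by (auto simp: not_less)
  then have "Z \<omega> \<subseteq> cball 0 r \<longleftrightarrow> \<not> (\<exists>n. C n \<inter> Z \<omega> \<noteq> {})" for \<omega>
    unfolding C by blast
  then have "{\<omega> \<in> space M. Z \<omega> \<subseteq> cball 0 r} = {\<omega> \<in> space M. \<not> (\<exists>n. C n \<inter> Z \<omega> \<noteq> {})}"
    by simp
  also have "\<dots> \<in> sets M"
    by (intro sets.sets_Collect_neg sets.sets_Collect_countable_Ex hit) (simp add: C_def compact_diff)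
  finally show ?thesis .
qed

lemma measurable_det:
  fixes A :: "'w \<Rightarrow> complex mat"
  assumes "\<And>\<omega>. \<omega> \<in> space M \<Longrightarrow> A \<omega> \<in> carrier_mat n n"
    and "\<And>i j. i < n \<Longrightarrow> j < n \<Longrightarrow> (\<lambda>\<omega>. A \<omega> $$ (i, j)) \<in> borel_measurable M"
  shows "(\<lambda>\<omega>. det (A \<omega>)) \<in> borel_measurable M"
proof -
  have leibniz: "(\<lambda>\<omega>. \<Sum>p\<in>{p. p permutes {0..<n}}. signof p * (\<Prod>i = 0..<n. A \<omega> $$ (i, p i))) \<in> borel_measurable M"
    by (intro borel_measurable_sum borel_measurable_times borel_measurable_prod borel_measurable_const assms(2))
       (auto simp: permutes_in_image)
  show ?thesis by (subst measurable_cong[OF det_def'[OF assms(1)]]) (assumption, rule leibniz)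
qed

lemma measurable_spectrum_hit:
  fixes A :: "'w \<Rightarrow> complex mat"
  assumes A: "\<And>\<omega>. \<omega> \<in> space M \<Longrightarrow> A \<omega> \<in> carrier_mat n n"
    and [measurable]: "\<And>i j. i < n \<Longrightarrow> j < n \<Longrightarrow> (\<lambda>\<omega>. A \<omega> $$ (i, j)) \<in> borel_measurable M"
    and "compact C"
  shows "{\<omega> \<in> space M. C \<inter> spectrum (A \<omega>) \<noteq> {}} \<in> sets M"
proof -
  have "{\<omega> \<in> space M. C \<inter> spectrum (A \<omega>) \<noteq> {}} = {\<omega> \<in> space M. \<exists>z\<in>C. poly (char_poly (A \<omega>)) z = 0}"
    by (auto simp: spectrum_root_char_poly[OF A])
  also have "\<dots> \<in> sets M"
  proof (rule measurable_ex_zero[OF \<open>compact C\<close>])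
    fix z assume "z \<in> C"
    have meas_det: "(\<lambda>\<omega>. det (- char_matrix (A \<omega>) z)) \<in> borel_measurable M"
    proof (rule measurable_det)
      fix i j assume ij: "i < n" "j < n"
      have entry: "(\<lambda>\<omega>. (if i = j then z else 0) - A \<omega> $$ (i, j)) \<in> borel_measurable M"
        using ij by measurable
      have eq: "(- char_matrix (A \<omega>) z) $$ (i, j) = (if i = j then z else 0) - A \<omega> $$ (i, j)"
        if "\<omega> \<in> space M" for \<omega>
        using carrier_matD[OF A[OF that]] ij by (auto simp: char_matrix_def)
      show "(\<lambda>\<omega>. (- char_matrix (A \<omega>) z) $$ (i, j)) \<in> borel_measurable M"
        by (subst measurable_cong[OF eq]) (assumption, rule entry)
    next
      fix \<omega> assume "\<omega> \<in> space M"
      from carrier_matD[OF A[OF this]] show "- char_matrix (A \<omega>) z \<in> carrier_mat n n"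
        by (auto simp: char_matrix_def)
    qed
    show "(\<lambda>\<omega>. poly (char_poly (A \<omega>)) z) \<in> borel_measurable M"
      by (subst measurable_cong[OF char_poly_matrix[OF A]]) (assumption, rule meas_det)
  qed (intro continuous_intros)
  finally show ?thesis .
qed

section \<open>Eigenvalues of a perturbed Jordan block\<close>

text \<open>The bound on the operator norm of \<open>K\<close> is assumed in the form in which it is applied, as an
  inequality for each vector.\<close>
locale jordan_perturbation =
  fixes N :: nat and K :: "complex mat" and \<delta> :: real
  assumes N_pos: "0 < N"
    and K_carrier [simp]: "K \<in> carrier_mat N N"
    and contraction: "\<And>u. fun_norm N (mat_act K u) \<le> fun_norm N u"
    and \<delta>_pos: "0 < \<delta>" and \<delta>N: "\<delta> * real N < 1 / 2"
begin

definition A :: "complex mat" where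
  "A = jordan_block N 0 + complex_of_real \<delta> \<cdot>\<^sub>m K"

lemma A_carrier [simp]: "A \<in> carrier_mat N N"
  by (simp add: A_def)

lemma \<delta>_less_half: "\<delta> < 1 / 2"
proof -
  have "\<delta> * 1 \<le> \<delta> * real N" using \<delta>_pos N_pos by (intro mult_left_mono) auto
  then show ?thesis using \<delta>N by simp
qed

abbreviation Kact :: "(nat \<Rightarrow> complex) \<Rightarrow> nat \<Rightarrow> complex" where
  "Kact u i \<equiv> \<delta> * mat_act K u i"

lemma dim_K [simp]: "dim_row K = N" "dim_col K = N"
  using K_carrier by (simp_all only: carrier_matD)

lemma sum_norm_Kact: "(\<Sum>k<N. cmod (Kact u k)) \<le> \<delta> * sqrt (real N) * fun_norm N u"
proof -
  have "(\<Sum>k<N. cmod (Kact u k)) \<le> sqrt (real N) * fun_norm N (Kact u)"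
    by (rule sum_norm_le_fun_norm)
  also have "fun_norm N (Kact u) \<le> \<delta> * fun_norm N u"
    using contraction[of u] \<delta>_pos by (simp add: fun_norm_mult)
  finally show ?thesis using N_pos by (simp add: mult_left_mono algebra_simps)
qed

lemma dim_A [simp]: "dim_row A = N" "dim_col A = N"
  using A_carrier by (simp_all only: carrier_matD)

lemma mat_act_A:
  assumes "i < N"
  shows "mat_act A u i = (if Suc i < N then u (Suc i) else 0) + Kact u i"
proof -
  have "mat_act A u i = (\<Sum>j<N. (if Suc i = j then 1 else 0) * u j + \<delta> * K $$ (i, j) * u j)"
    using assms unfolding mat_act_def by (auto simp: A_def algebra_simps intro!: sum.cong)
  also have "\<dots> = (\<Sum>j<N. if Suc i = j then u j else 0) + (\<Sum>j<N. \<delta> * K $$ (i, j) * u j)"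
    unfolding sum.distrib by (intro arg_cong2[of _ _ _ _ "(+)"] sum.cong) auto
  also have "\<dots> = (if Suc i < N then u (Suc i) else 0) + Kact u i"
    by (simp add: mat_act_def sum_distrib_left mult.assoc)
  finally show ?thesis .
qed

text \<open>Solving \<open>z u\<^sub>i = u\<^sub>i\<^sub>+\<^sub>1 + (\<delta>K u)\<^sub>i\<close> backwards from \<open>u\<^sub>N = 0\<close> bounds each \<open>|z|\<^bsup>N\<^esup> |u\<^sub>i|\<close> by the
  sum of the \<open>|(\<delta>K u)\<^sub>k|\<close> when \<open>|z| \<le> 1\<close>. Passing from the maximum on the left and from the sum on
  the right to the Euclidean norm costs a factor \<open>\<surd>N\<close> each, so \<open>|z|\<^bsup>N\<^esup> \<parallel>u\<parallel> \<le> \<delta>N \<parallel>u\<parallel>\<close>.\<close>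
lemma eigenvalue_bound:
  assumes "eigenvalue A z"
  shows "cmod z ^ N \<le> \<delta> * real N"
proof -
  obtain v where v: "v \<in> carrier_vec N" "v \<noteq> 0\<^sub>v N" "A *\<^sub>v v = z \<cdot>\<^sub>v v"
    using assms by (auto simp: eigenvalue_def eigenvector_def A_def)
  define u where "u = (\<lambda>i. if i < N then v $ i else 0)"
  have vu: "Matrix.vec N u = v" using v(1) by (auto simp: u_def)
  have u: "z * u i = u (Suc i) + Kact u i" if "i < N" for i
  proof -
    have "mat_act A u i = z * u i"
      using mat_act_vec[OF A_carrier that, of u] v that unfolding vu by (simp add: u_def)
    then show ?thesis using mat_act_A[OF that, of u] by (auto simp: u_def)
  qed
  \<comment> \<open>Replacing \<open>cmod z\<close> by \<open>m\<close> treats \<open>cmod z > 1\<close> alongside: there it gives \<open>1 \<le> \<delta> * N\<close>, which is absurd.\<close>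
  define m where "m = min 1 (cmod z)"
  have m: "0 \<le> m" "m \<le> 1" "m \<le> cmod z" by (auto simp: m_def)
  have bound: "m ^ k * cmod (u (N - k)) \<le> (\<Sum>i<N. cmod (Kact u i))" if "k \<le> N" for k
  proof -
    have "m ^ k * cmod (u (N - k)) \<le> (\<Sum>i\<in>{N-k..<N}. cmod (Kact u i))"
      using that
    proof (induction k)
      case (Suc k)
      let ?i = "N - Suc k"
      have i: "?i < N" "Suc ?i = N - k" using Suc.prems by auto
      have "m ^ Suc k * cmod (u ?i) \<le> m ^ k * (cmod z * cmod (u ?i))"
        using m by (simp add: mult_right_mono mult_left_mono mult.assoc mult.left_commute)
      also have "\<dots> = m ^ k * cmod (u (N - k) + Kact u ?i)"
        using u[OF i(1)] i(2) by (metis norm_mult)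
      also have "\<dots> \<le> m ^ k * (cmod (u (N - k)) + cmod (Kact u ?i))"
        using m by (intro mult_left_mono norm_triangle_ineq) auto
      also have "\<dots> = m ^ k * cmod (u (N - k)) + m ^ k * cmod (Kact u ?i)"
        by (rule distrib_left)
      also have "\<dots> \<le> (\<Sum>i\<in>{N-k..<N}. cmod (Kact u i)) + cmod (Kact u ?i)"
        using Suc m power_le_one[of m k] by (intro add_mono mult_left_le_one_le) auto
      also have "\<dots> = (\<Sum>i\<in>{?i..<N}. cmod (Kact u i))"
        using i by (simp add: sum.atLeast_Suc_lessThan)
      finally show ?case .
    qed (simp add: u_def)
    also have "\<dots> \<le> (\<Sum>i<N. cmod (Kact u i))" by (rule sum_mono2) auto
    finally show ?thesis .
  qed
  have "fun_norm N (\<lambda>i. complex_of_real (m ^ N) * u i)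
      \<le> sqrt (real N) * (\<delta> * sqrt (real N) * fun_norm N u)"
  proof (rule fun_norm_le_sqrt_mult)
    fix i assume "i < N"
    have "m ^ N * cmod (u i) \<le> m ^ (N - i) * cmod (u i)"
      using m by (intro mult_right_mono power_decreasing) auto
    also have "\<dots> \<le> (\<Sum>i<N. cmod (Kact u i))" using bound[of "N - i"] \<open>i < N\<close> by simp
    finally show "cmod (complex_of_real (m ^ N) * u i) \<le> \<delta> * sqrt (real N) * fun_norm N u"
      using sum_norm_Kact[of u] m by (simp add: norm_mult norm_power)
  qed
  also have "\<dots> = (sqrt (real N) * sqrt (real N)) * \<delta> * fun_norm N u"
    by (simp only: ac_simps)
  finally have "m ^ N * fun_norm N u \<le> (\<delta> * real N) * fun_norm N u"
    unfolding fun_norm_mult using m by (simp add: norm_power mult.commute)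
  moreover have "fun_norm N u \<noteq> 0"
  proof
    assume "fun_norm N u = 0"
    then have "v = 0\<^sub>v N" using v(1) fun_norm_eq_0[of N u] by (intro eq_vecI) (auto simp: u_def)
    then show False using v(2) by simp
  qed
  ultimately have "m ^ N \<le> \<delta> * real N"
    using fun_norm_nonneg[of N u] by (metis mult_le_cancel_right order_le_less not_less)
  then show ?thesis using \<delta>N by (auto simp: m_def min_def split: if_splits)
qed

text \<open>The recursion states all rows of \<open>(z - A) u = 0\<close> except the last. By
  \<open>recursion_deviation\<close>, \<open>\<parallel>u\<parallel>\<close> is at most \<open>\<surd>N |u\<^sub>0| + \<delta>N \<parallel>u\<parallel>\<close>, and
  \<open>\<delta>N < 1/2\<close> lets the second term be absorbed.\<close>
lemma recursion_norm_bound: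
  assumes z: "cmod z \<le> 1" and rec: "\<And>i. Suc i < N \<Longrightarrow> u (Suc i) = z * u i - Kact u i"
  shows "fun_norm N u \<le> 2 * sqrt (real N) * cmod (u 0)"
proof -
  have "fun_norm N u \<le> sqrt (real N) * (cmod (u 0) + \<delta> * sqrt (real N) * fun_norm N u)"
  proof (rule fun_norm_le_sqrt_mult)
    fix i assume i: "i < N"
    have "cmod (u i - z ^ i * u 0) \<le> (\<Sum>k<i. cmod (Kact u k))"
      by (rule recursion_deviation[OF z, where m = "N - 1"]) (use rec i in auto)
    also have "\<dots> \<le> (\<Sum>k<N. cmod (Kact u k))" using i by (intro sum_mono2) auto
    finally have "cmod (u i - z ^ i * u 0) \<le> \<delta> * sqrt (real N) * fun_norm N u"
      using sum_norm_Kact[of u] by simp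
    moreover have "cmod (z ^ i * u 0) \<le> cmod (u 0)"
      using z by (simp add: norm_mult norm_power power_le_one mult_left_le_one_le)
    ultimately show "cmod (u i) \<le> cmod (u 0) + \<delta> * sqrt (real N) * fun_norm N u"
      using norm_triangle_ineq[of "z ^ i * u 0" "u i - z ^ i * u 0"] by simp
  qed
  also have "\<dots> = sqrt (real N) * cmod (u 0) + (\<delta> * real N) * fun_norm N u"
    by (simp add: algebra_simps)
  also have "\<dots> \<le> sqrt (real N) * cmod (u 0) + 1 / 2 * fun_norm N u"
    using \<delta>N by (intro add_left_mono mult_right_mono) auto
  finally show ?thesis by simp
qed

lemma last_row_upper:
  assumes z: "cmod z \<le> 1" and rec: "\<And>i. Suc i < N \<Longrightarrow> u (Suc i) = z * u i - Kact u i"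
  shows "cmod (z * u (N - 1) - Kact u (N - 1)) \<le> (cmod z ^ N + 2 * (\<delta> * real N)) * cmod (u 0)"
proof -
  \<comment> \<open>The last row continues the recursion by one step if its value is stored as \<open>u N\<close>.\<close>
  define c where "c = z * u (N - 1) - Kact u (N - 1)"
  have "cmod ((u(N := c)) N - z ^ N * (u(N := c)) 0) \<le> (\<Sum>k<N. cmod (Kact u k))"
  proof (rule recursion_deviation[OF z, where m = N])
    fix i assume i: "i < N"
    show "(u(N := c)) (Suc i) = z * (u(N := c)) i - Kact u i"
    proof (cases "Suc i = N")
      case True
      then have "i = N - 1" by simp
      then show ?thesis using True by (simp add: c_def)
    qed (use i rec[of i] in auto)
  qed simp
  then have "cmod (c - z ^ N * u 0) \<le> \<delta> * sqrt (real N) * fun_norm N u"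
    using sum_norm_Kact[of u] N_pos by simp
  also have "\<dots> \<le> \<delta> * sqrt (real N) * (2 * sqrt (real N) * cmod (u 0))"
    using recursion_norm_bound[OF z rec] \<delta>_pos by (intro mult_left_mono) auto
  also have "\<dots> = 2 * (\<delta> * real N) * cmod (u 0)" by (simp add: algebra_simps)
  finally have "cmod (c - z ^ N * u 0) \<le> 2 * (\<delta> * real N) * cmod (u 0)" .
  moreover have "cmod c \<le> cmod (z ^ N * u 0) + cmod (c - z ^ N * u 0)"
    using norm_triangle_ineq[of "z ^ N * u 0" "c - z ^ N * u 0"] by simp
  ultimately show ?thesis unfolding c_def by (simp add: norm_mult norm_power algebra_simps)
qed

text \<open>At \<open>z = 0\<close> the unperturbed solution is supported on coordinate \<open>0\<close>; the remaining entries
  \<open>u'\<close> have norm at most \<open>2\<delta> |u\<^sub>0|\<close>. Hence the last row of \<open>K u\<close> differs from its bottom-left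
  contribution by at most that much.\<close>
lemma last_row_lower:
  assumes rec: "\<And>i. Suc i < N \<Longrightarrow> u (Suc i) = - Kact u i"
  shows "\<delta> * (cmod (K $$ (N - 1, 0)) - 2 * \<delta>) * cmod (u 0) \<le> cmod (Kact u (N - 1))"
proof -
  define u' where "u' = u(0 := 0)"
  obtain m where m: "N = Suc m" using N_pos by (cases N) auto
  \<comment> \<open>Entries \<open>1, ..., N - 1\<close> of \<open>u\<close> are, up to sign, the first \<open>N - 1\<close> entries of the perturbation term.\<close>
  have "fun_norm N u' = L2_set (\<lambda>i. cmod (Kact u i)) {..<m}"
    unfolding fun_norm_def L2_set_def m sum.lessThan_Suc_shift
    by (intro arg_cong[of _ _ sqrt]) (auto simp: u'_def m rec intro!: sum.cong)
  also have "\<dots> \<le> fun_norm N (Kact u)"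
    unfolding fun_norm_def L2_set_def by (intro real_sqrt_le_mono sum_mono2) (auto simp: m)
  also have "\<dots> \<le> \<delta> * fun_norm N u"
    using contraction[of u] \<delta>_pos by (simp add: fun_norm_mult)
  finally have u'_le: "fun_norm N u' \<le> \<delta> * fun_norm N u" .
  let ?e = "\<lambda>i. if i = 0 then u 0 else 0"
  have u_split: "u = (\<lambda>i. ?e i + u' i)" by (auto simp: u'_def)
  have "fun_norm N ?e = cmod (u 0)"
    unfolding fun_norm_def L2_set_def m sum.lessThan_Suc_shift by simp
  then have "fun_norm N u \<le> cmod (u 0) + fun_norm N u'"
    using fun_norm_triangle[of N ?e u'] u_split by simp
  then have "fun_norm N u' \<le> \<delta> * (cmod (u 0) + fun_norm N u')"
    using u'_le \<delta>_pos by (meson mult_left_mono less_imp_le order_trans)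
  also have "\<dots> \<le> \<delta> * cmod (u 0) + 1 / 2 * fun_norm N u'"
    unfolding distrib_left using \<delta>_less_half by (intro add_left_mono mult_right_mono) auto
  finally have u'_small: "fun_norm N u' \<le> 2 * \<delta> * cmod (u 0)" by simp
  have "mat_act K u (N - 1) = (\<Sum>j<N. K $$ (N - 1, j) * ?e j) + mat_act K u' (N - 1)"
    by (subst u_split) (simp add: mat_act_def distrib_left sum.distrib)
  also have "(\<Sum>j<N. K $$ (N - 1, j) * ?e j) = K $$ (N - 1, 0) * u 0"
    unfolding m sum.lessThan_Suc_shift by simp
  finally have eq: "mat_act K u (N - 1) = K $$ (N - 1, 0) * u 0 + mat_act K u' (N - 1)" .
  have "cmod (mat_act K u' (N - 1)) \<le> 2 * \<delta> * cmod (u 0)"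
    using norm_le_fun_norm[of "N - 1" N "mat_act K u'"] contraction[of u'] u'_small N_pos by simp
  then have "(cmod (K $$ (N - 1, 0)) - 2 * \<delta>) * cmod (u 0) \<le> cmod (mat_act K u (N - 1))"
    using norm_triangle_ineq2[of "K $$ (N - 1, 0) * u 0" "- mat_act K u' (N - 1)"] eq
    by (simp add: norm_mult algebra_simps)
  then show ?thesis using \<delta>_pos by (simp add: norm_mult mult.assoc)
qed


lemma mat_act_resolvent:
  assumes "i < N"
  shows "mat_act (- char_matrix A z) u i = z * u i - mat_act A u i"
proof -
  have "mat_act (- char_matrix A z) u i = (\<Sum>j<N. (if i = j then z * u j else 0) - A $$ (i, j) * u j)"
    unfolding mat_act_def
  proof (intro sum.cong)
    show "{..<dim_col (- char_matrix A z)} = {..<N}"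
      by (simp add: char_matrix_def)
  qed (use assms in \<open>auto simp: char_matrix_def algebra_simps\<close>)
  also have "\<dots> = z * u i - mat_act A u i"
    using assms by (simp add: sum_subtractf mat_act_def)
  finally show ?thesis .
qed

lemma resolvent_carrier: "- char_matrix A z \<in> carrier_mat N N"
  by (auto simp: char_matrix_def)

text \<open>The last column of the adjugate of \<open>z - A\<close>.\<close>
definition adj_col :: "complex \<Rightarrow> nat \<Rightarrow> complex" where
  "adj_col z i = cofactor (- char_matrix A z) (N - 1) i"

text \<open>This is the last column of the identity \<open>B * adj B = det B * 1\<close> for \<open>B = z - A\<close>.\<close>
lemma adj_col_equation:
  assumes "i < N"
  shows "z * adj_col z i - mat_act A (adj_col z) i = (if i = N - 1 then poly (char_poly A) z else 0)"
proof -
  let ?B = "- char_matrix A z"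
  have "mat_act ?B (adj_col z) i = (?B * adj_mat ?B) $$ (i, N - 1)"
    using assms N_pos carrier_matD[OF resolvent_carrier[of z]]
    by (auto simp: mat_act_def scalar_prod_def adj_mat_def adj_col_def lessThan_atLeast0 sum_negf intro!: sum.cong)
  also have "\<dots> = (if i = N - 1 then det ?B else 0)"
    using assms N_pos by (simp add: adj_mat(2)[OF resolvent_carrier])
  finally show ?thesis
    using assms by (simp add: mat_act_resolvent char_poly_matrix[OF A_carrier])
qed

lemma adj_col_recursion:
  assumes "Suc i < N"
  shows "adj_col z (Suc i) = z * adj_col z i - Kact (adj_col z) i"
  using adj_col_equation[of i z] mat_act_A[of i "adj_col z"] assms by (simp add: algebra_simps)

lemma char_poly_eq_last_row:
  "poly (char_poly A) z = z * adj_col z (N - 1) - Kact (adj_col z) (N - 1)"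
  using adj_col_equation[of "N - 1" z] mat_act_A[of "N - 1" "adj_col z"] N_pos by simp

text \<open>The first entry of the column, as a polynomial in \<open>z\<close>: taking the cofactor in the matrix of
  polynomials makes holomorphy immediate.\<close>
definition corner_minor :: "complex poly" where
  "corner_minor = cofactor (char_poly_matrix A) (N - 1) 0"

lemma poly_corner_minor: "poly corner_minor z = adj_col z 0"
proof -
  have "poly (det (mat_delete (char_poly_matrix A) (N - 1) 0)) z
      = det (mat_delete (- char_matrix A z) (N - 1) 0)"
  proof (rule poly_det_cong)
    show "mat_delete (- char_matrix A z) (N - 1) 0 \<in> carrier_mat (N - 1) (N - 1)"
      by (rule mat_delete_carrier[OF resolvent_carrier])
    show "mat_delete (char_poly_matrix A) (N - 1) 0 \<in> carrier_mat (N - 1) (N - 1)"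
      by (rule mat_delete_carrier) simp
  qed (auto simp: mat_delete_def char_poly_matrix_def char_matrix_def)
  then show ?thesis by (simp add: corner_minor_def adj_col_def cofactor_def)
qed

text \<open>The minor drops the last row and the first column, so a kernel vector of it, extended by \<open>0\<close>
  in front, solves the recursion with \<open>u\<^sub>0 = 0\<close>. Such a solution vanishes by
  \<open>recursion_norm_bound\<close>.\<close>
lemma corner_minor_nonzero:
  assumes z: "cmod z \<le> 1"
  shows "poly corner_minor z \<noteq> 0"
proof
  let ?B = "- char_matrix A z"
  let ?D = "mat_delete ?B (N - 1) 0"
  have D: "?D \<in> carrier_mat (N - 1) (N - 1)" by (rule mat_delete_carrier[OF resolvent_carrier])
  assume "poly corner_minor z = 0"
  then have "det ?D = 0" by (simp add: poly_corner_minor adj_col_def cofactor_def)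
  then obtain v where v: "v \<in> carrier_vec (N - 1)" "v \<noteq> 0\<^sub>v (N - 1)" "?D *\<^sub>v v = 0\<^sub>v (N - 1)"
    using det_0_iff_vec_prod_zero_field[OF D] by blast
  define u where "u i = (case i of 0 \<Rightarrow> 0 | Suc j \<Rightarrow> v $ j)" for i
  obtain m where m: "N = Suc m" using N_pos by (cases N) auto
  have rec: "u (Suc i) = z * u i - Kact u i" if i: "Suc i < N" for i
  proof -
    have "mat_act ?B u i = (\<Sum>j<m. ?B $$ (i, Suc j) * v $ j)"
      using carrier_matD(2)[OF resolvent_carrier[of z]] unfolding mat_act_def
      by (simp add: m sum.lessThan_Suc_shift u_def del: sum.lessThan_Suc)
    also have "\<dots> = (?D *\<^sub>v v) $ i"
      using i v(1) carrier_matD[OF resolvent_carrier[of z]]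
      by (auto simp: m mat_delete_def scalar_prod_def lessThan_atLeast0 intro!: sum.cong)
    also have "\<dots> = 0" using v(3) i by simp
    finally show ?thesis using i mat_act_resolvent[of i z u] mat_act_A[of i u] by (simp add: algebra_simps)
  qed
  have "u 0 = 0" by (simp add: u_def)
  then have "fun_norm N u \<le> 0" using recursion_norm_bound[OF z rec] by simp
  then have "fun_norm N u = 0" using fun_norm_nonneg[of N u] by linarith
  then have "u (Suc j) = 0" if "j < N - 1" for j using fun_norm_eq_0[of N u "Suc j"] that by simp
  then have "v = 0\<^sub>v (N - 1)" using v(1) by (intro eq_vecI) (auto simp: u_def)
  then show False using v(2) by simp
qed

lemma card_small_eigenvalues:
  assumes K: "5 * \<alpha> \<le> cmod (K $$ (N - 1, 0))" and \<alpha>: "\<delta> \<le> \<alpha>" and \<sigma>: "0 < \<sigma>"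
  shows "real (card (spectrum A \<inter> cball 0 ((\<delta> * real N) powr (1 / real N) * exp (- \<sigma>))))
         \<le> 1 / \<sigma> * (ln (real N) - ln \<alpha>)"
proof -
  define R where "R = (\<delta> * real N) powr (1 / real N)"
  have \<delta>N_pos: "0 < \<delta> * real N" using \<delta>_pos N_pos by simp
  have "0 < R" using \<delta>_pos N_pos by (simp add: R_def)
  moreover from this have "R ^ N = \<delta> * real N"
    using \<delta>N_pos N_pos powr_realpow[of R N] by (simp add: R_def powr_powr)
  ultimately have R: "0 < R" "R ^ N = \<delta> * real N" by auto
  have "R \<le> 1" using \<delta>N \<delta>N_pos by (auto simp: R_def intro: powr_le1)
  let ?S = "spectrum A \<inter> cball 0 (R * exp (- \<sigma>))"
  have \<alpha>_pos: "0 < \<alpha>" using \<alpha> \<delta>_pos by simp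
  have "3 * \<alpha> * \<delta> * exp (\<sigma> * card ?S) \<le> 3 * (\<delta> * real N)"
  proof (rule jensen_bound[where p = "char_poly A" and d = corner_minor and R = R])
    show "finite ?S" using card_finite_spectrum(1)[OF A_carrier] by simp
    show "poly (char_poly A) z = 0" if "z \<in> ?S" for z
      using that by (simp add: spectrum_root_char_poly[OF A_carrier])
    show "poly corner_minor z \<noteq> 0" if "cmod z \<le> R" for z
      using corner_minor_nonzero that \<open>R \<le> 1\<close> by simp
    show "cmod (poly (char_poly A) z) \<le> 3 * (\<delta> * real N) * cmod (poly corner_minor z)"
      if "cmod z = R" for z
      using last_row_upper[of z "adj_col z", OF _ adj_col_recursion] that \<open>R \<le> 1\<close> R(2)
      by (simp add: char_poly_eq_last_row poly_corner_minor)
    \<comment> \<open>\<open>5 * \<alpha> - 2 * \<delta> \<ge> 3 * \<alpha>\<close>, which matches the constant 3 of the upper bound so that both cancel.\<close>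
    have "3 * \<alpha> * \<delta> \<le> \<delta> * (cmod (K $$ (N - 1, 0)) - 2 * \<delta>)"
      using K \<alpha> \<delta>_pos by (simp add: mult.commute[of _ \<delta>])
    then have "3 * \<alpha> * \<delta> * cmod (adj_col 0 0) \<le> \<delta> * (cmod (K $$ (N - 1, 0)) - 2 * \<delta>) * cmod (adj_col 0 0)"
      by (rule mult_right_mono) simp
    also have "\<dots> \<le> cmod (poly (char_poly A) 0)"
      using last_row_lower[of "adj_col 0"] adj_col_recursion[of _ 0]
      by (simp add: char_poly_eq_last_row)
    finally show "3 * \<alpha> * \<delta> * cmod (poly corner_minor 0) \<le> cmod (poly (char_poly A) 0)"
      by (simp add: poly_corner_minor)
  qed (use R in auto)
  then have "\<alpha> * exp (\<sigma> * card ?S) \<le> real N" using \<delta>_pos by (simp add: field_simps)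
  then have "ln (\<alpha> * exp (\<sigma> * card ?S)) \<le> ln (real N)"
    using \<alpha>_pos N_pos by (subst ln_le_cancel_iff) auto
  then have "ln \<alpha> + \<sigma> * card ?S \<le> ln (real N)" using \<alpha>_pos by (simp add: ln_mult)
  then show ?thesis using \<sigma> by (simp add: R_def field_simps)
qed

lemma spectrum_subset: "spectrum A \<subseteq> cball 0 ((\<delta> * real N) powr (1 / real N))"
proof
  fix z assume "z \<in> spectrum A"
  then have z: "cmod z ^ N \<le> \<delta> * real N" using eigenvalue_bound by (simp add: spectrum_def)
  have "cmod z = (cmod z ^ N) powr (1 / real N)"
    using N_pos by (cases "z = 0") (auto simp: powr_powr simp flip: powr_realpow)
  also have "\<dots> \<le> (\<delta> * real N) powr (1 / real N)"
    using z by (intro powr_mono2) auto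
  finally show "z \<in> cball 0 ((\<delta> * real N) powr (1 / real N))" by simp
qed

end

section \<open>The probabilistic statement\<close>
theorem theorem2:
  fixes M :: "'w measure" and K :: "'w \<Rightarrow> complex mat" and N :: nat
    and p1 :: "nat \<Rightarrow> real" and p2 :: "real \<Rightarrow> nat \<Rightarrow> real"
    and \<delta> \<alpha> \<sigma> :: real
  assumes "prob_space M"
    and "N > 2"
    and "\<And>\<omega>. \<omega> \<in> space M \<Longrightarrow> K \<omega> \<in> carrier_mat N N"
    and "\<And>i j. i < N \<Longrightarrow> j < N \<Longrightarrow> (\<lambda>\<omega>. K \<omega> $$ (i, j)) \<in> borel_measurable M"
    and "\<P>(\<omega> in M. mat_op_norm (K \<omega>) < 1) \<ge> 1 - p1 N"
    and "\<And>s. s > 0 \<Longrightarrow> \<P>(\<omega> in M. cmod (K \<omega> $$ (N - 1, 0)) < s) \<le> p2 s N"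
    and "0 < \<delta>" and "\<delta> < 1 / (2 * real N)"
    and "\<alpha> \<ge> \<delta>"
    and "\<sigma> > 0"
  shows "\<P>(\<omega> in M.
            spectrum (jordan_block N 0 + complex_of_real \<delta> \<cdot>\<^sub>m K \<omega>)
              \<subseteq> cball 0 ((\<delta> * real N) powr (1 / real N))
          \<and> real (card (spectrum (jordan_block N 0 + complex_of_real \<delta> \<cdot>\<^sub>m K \<omega>)
                     \<inter> cball 0 ((\<delta> * real N) powr (1 / real N) * exp (- \<sigma>))))
              \<le> 1 / \<sigma> * (ln (real N) - ln \<alpha>))
         \<ge> 1 - p1 N - p2 (5 * \<alpha>) N"
proof -
  interpret prob_space M by fact
  let ?A = "\<lambda>\<omega>. jordan_block N 0 + complex_of_real \<delta> \<cdot>\<^sub>m K \<omega>"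
  let ?R = "(\<delta> * real N) powr (1 / real N)"
  let ?good = "\<lambda>\<omega>. spectrum (?A \<omega>) \<subseteq> cball 0 ?R
    \<and> real (card (spectrum (?A \<omega>) \<inter> cball 0 (?R * exp (- \<sigma>)))) \<le> 1 / \<sigma> * (ln (real N) - ln \<alpha>)"
  note K = assms(3) and [measurable] = assms(4)
  have \<alpha>: "0 < 5 * \<alpha>" using assms(7,9) by simp
  have A: "?A \<omega> \<in> carrier_mat N N" if "\<omega> \<in> space M" for \<omega> using K[OF that] by simp
  have A_meas: "(\<lambda>\<omega>. ?A \<omega> $$ (i, j)) \<in> borel_measurable M" if ij: "i < N" "j < N" for i j
  proof -
    have entry: "(\<lambda>\<omega>. jordan_block N 0 $$ (i, j) + complex_of_real \<delta> * K \<omega> $$ (i, j)) \<in> borel_measurable M"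
      using ij by measurable
    have eq: "?A \<omega> $$ (i, j) = jordan_block N 0 $$ (i, j) + complex_of_real \<delta> * K \<omega> $$ (i, j)"
      if "\<omega> \<in> space M" for \<omega>
      using ij carrier_matD[OF K[OF that]] by simp
    show ?thesis by (subst measurable_cong[OF eq]) (assumption, rule entry)
  qed
  note hit = measurable_spectrum_hit[of M ?A N, OF A A_meas]
  have fin: "finite (spectrum (?A \<omega>))" if "\<omega> \<in> space M" for \<omega>
    by (rule card_finite_spectrum(1)[OF A[OF that]])
  have [measurable]: "{\<omega> \<in> space M. spectrum (?A \<omega>) \<subseteq> cball 0 ?R} \<in> sets M"
    by (rule measurable_subset_cball_of_hits[OF hit])
  have [measurable]: "(\<lambda>\<omega>. real (card (spectrum (?A \<omega>) \<inter> cball 0 (?R * exp (- \<sigma>))))) \<in> borel_measurable M"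
    by (rule measurable_card_of_hits[OF fin hit closed_cball])
  have good_sets: "{\<omega> \<in> space M. ?good \<omega>} \<in> events"
    by measurable
  let ?E = "{\<omega> \<in> space M. mat_op_norm (K \<omega>) < 1}"
  let ?F = "{\<omega> \<in> space M. cmod (K \<omega> $$ (N - 1, 0)) < 5 * \<alpha>}"
  have F: "?F \<in> events" "prob ?F \<le> p2 (5 * \<alpha>) N"
    using assms(2,4) by measurable (use assms(2,6) \<alpha> in auto)
  have sub: "?E - ?F \<subseteq> {\<omega> \<in> space M. ?good \<omega>}"
  proof
    fix \<omega> assume \<omega>: "\<omega> \<in> ?E - ?F"
    then have "\<omega> \<in> space M" "mat_op_norm (K \<omega>) < 1" and corner: "5 * \<alpha> \<le> cmod (K \<omega> $$ (N - 1, 0))"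
      by auto
    then have "jordan_perturbation N (K \<omega>) \<delta>"
      using K[of \<omega>] mat_act_le_of_op_norm[of "K \<omega>" N] assms(2,7,8)
      by (intro jordan_perturbation.intro) (auto simp: field_simps)
    then interpret P: jordan_perturbation N "K \<omega>" \<delta> .
    show "\<omega> \<in> {\<omega> \<in> space M. ?good \<omega>}"
      using \<open>\<omega> \<in> space M\<close> P.spectrum_subset P.card_small_eigenvalues[OF corner assms(9,10)]
      unfolding P.A_def by blast
  qed
  show ?thesis
  proof (cases "?E \<in> events")
    case True
    have "prob ?E \<le> prob (?E - ?F) + prob ?F"
      using finite_measure_Diff'[OF True F(1)] finite_measure_mono[of "?E \<inter> ?F" ?F] F(1) by auto
    moreover have "prob (?E - ?F) \<le> prob {\<omega> \<in> space M. ?good \<omega>}"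
      by (rule finite_measure_mono[OF sub good_sets])
    ultimately show ?thesis using assms(5) F(2) by linarith
  next
    case False
    \<comment> \<open>The hypothesis then reads \<open>p1 N \<ge> 1\<close> and the bound to be shown is not positive.\<close>
    then have "prob ?E = 0" by (rule measure_notin_sets)
    then have "1 - p1 N \<le> 0" using assms(5) by simp
    moreover have "0 \<le> p2 (5 * \<alpha>) N" using F(2) measure_nonneg[of M ?F] by linarith
    moreover have "0 \<le> prob {\<omega> \<in> space M. ?good \<omega>}" by (rule measure_nonneg)
    ultimately show ?thesis by linarith
  qed
qed

end
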